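(* Let $n \geqslant 12$ be an integer and let $E_n=\{x_i+x_j=x_k,~x_i \cdot x_j=x_k \colon i,j,k \in \{1,\ldots,n\}\}$. Let $T_n$ be the following system of equations in the variables $x_1,\ldots,x_n$: \[ \left\{\begin{array}{rcl} \forall i \in \{1,\ldots,n-12\} ~x_i \cdot x_i &=& x_{i+1} \\ x_{n-10} \cdot x_{n-10} &=& x_{n-10} \\ x_{n-10}+x_{n-10} &=& x_{n-9} \\ x_{n-8}+x_{n-9} &=& x_{1} \\ x_{n-8} \cdot x_{n-7} &=& x_{n-11} \\ x_{n-10} \cdot x_{n-7} &=& x_{n-7} \\ x_{n-6} \cdot x_{n-6} &=& x_{n-5} \\ x_{n-4} \cdot x_{n-4} &=& x_{n-3} \\ x_{n-2} \cdot x_{n-2} &=& x_{n-1} \\ x_{n-5}+x_{n-3} &=& x_n \\ x_{n-1}+x_n &=& x_{n-11} \end{array}\right. \] Then $T_n \subseteq E_n$, and $T_n$ has exactly \[ 1+\sum_{k=0}^{2^{n-12}} \left( r_3\!\left(\left(2+2^k\right)^{2^{n-12}}\right) + r_3\!\left(\left(2-2^k\right)^{2^{n-12}}\right)\right) \] solutions in integers $x_1,\ldots,x_n$ (the paper writes this sum as $1+\sum_{k=0}^{2^{n-12}} r_3\left(\left(2 \pm 2^k\right)^{2^{n-12}}\right)$, the sum running over both signs).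
   Context: For a non-negative integer $m$, $r_3(m)$ denotes the number of triples $(a,b,c)\in\mathbb Z^3$ with $a^2+b^2+c^2=m$. *)

theory Defs
  imports Main "HOL-Library.FuncSet"
begin

text \<open>Equations are kept as syntactic objects, so that inclusion between systems is
  inclusion of sets of equations, not of solution sets:
  \<open>Add i j k\<close> stands for $x_i + x_j = x_k$ and \<open>Mul i j k\<close> for $x_i \cdot x_j = x_k$.\<close>

datatype equation = Add nat nat nat | Mul nat nat nat

fun holds :: "(nat \<Rightarrow> int) \<Rightarrow> equation \<Rightarrow> bool" where
  "holds x (Add i j k) \<longleftrightarrow> x i + x j = x k"
| "holds x (Mul i j k) \<longleftrightarrow> x i * x j = x k"

text \<open>A tuple $(x_1, \ldots, x_n)$ is an extensional function on \<open>{1..n}\<close>: it takes the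
  fixed value \<open>undefined\<close> outside \<open>{1..n}\<close>, so each tuple is represented exactly once.\<close>

definition solutions :: "nat \<Rightarrow> equation set \<Rightarrow> (nat \<Rightarrow> int) set" where
  "solutions n S = {x \<in> {1..n} \<rightarrow>\<^sub>E (UNIV :: int set). \<forall>e \<in> S. holds x e}"

definition E_sys :: "nat \<Rightarrow> equation set" where
  "E_sys n =
     {Add i j k | i j k. i \<in> {1..n} \<and> j \<in> {1..n} \<and> k \<in> {1..n}} \<union>
     {Mul i j k | i j k. i \<in> {1..n} \<and> j \<in> {1..n} \<and> k \<in> {1..n}}"

text \<open>Intended for \<open>n \<ge> 12\<close>, where no index subtraction is truncated.\<close>

definition T_sys :: "nat \<Rightarrow> equation set" where
  "T_sys n =
     {Mul i i (i + 1) | i. i \<in> {1..n - 12}} \<union>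
     {Mul (n - 10) (n - 10) (n - 10),
      Add (n - 10) (n - 10) (n - 9),
      Add (n - 8) (n - 9) 1,
      Mul (n - 8) (n - 7) (n - 11),
      Mul (n - 10) (n - 7) (n - 7),
      Mul (n - 6) (n - 6) (n - 5),
      Mul (n - 4) (n - 4) (n - 3),
      Mul (n - 2) (n - 2) (n - 1),
      Add (n - 5) (n - 3) n,
      Add (n - 1) n (n - 11)}"

text \<open>The argument is an integer so that differences need no conversion to \<open>nat\<close>;
  only \<open>m \<ge> 0\<close> is of interest.\<close>

definition r3 :: "int \<Rightarrow> nat" where
  "r3 m = card {(a :: int, b :: int, c :: int). a\<^sup>2 + b\<^sup>2 + c\<^sup>2 = m}"

end

theory Submission
  imports Defs "HOL-Computational_Algebra.Primes"
begin

text \<open>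
  Put \<open>N = 2 ^ (n - 12)\<close>. A solution is determined by \<open>e = x (n - 10)\<close>, \<open>t = x 1\<close> and the three
  numbers \<open>a, b, c\<close> with \<open>a\<^sup>2 + b\<^sup>2 + c\<^sup>2 = t ^ N\<close>. Either \<open>e = 0\<close>, which forces every variable to
  vanish, or \<open>e = 1\<close> and \<open>t - 2\<close> divides \<open>t ^ N\<close>. Since \<open>t \<equiv> 2\<close> modulo \<open>t - 2\<close>, the latter means
  that \<open>t - 2\<close> divides \<open>2 ^ N\<close>, that is, \<open>t = 2 \<plusminus> 2 ^ k\<close> with \<open>k \<le> N\<close>.
\<close>

section \<open>Three-square representations and the admissible values of \<open>t\<close>\<close>

definition square_triples :: "int \<Rightarrow> (int \<times> int \<times> int) set" where
  "square_triples m = {(a, b, c). a\<^sup>2 + b\<^sup>2 + c\<^sup>2 = m}"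

definition admissible :: "nat \<Rightarrow> int set" where
  "admissible N = {t. t \<noteq> 2 \<and> t - 2 dvd t ^ N}"

lemma r3_eq_card_square_triples: "r3 m = card (square_triples m)"
  by (simp add: r3_def square_triples_def)

lemma abs_le_power2_int: "\<bar>a\<bar> \<le> (a::int)\<^sup>2"
proof (cases "a = 0")
  case False
  then have "\<bar>a\<bar> * 1 \<le> \<bar>a\<bar> * \<bar>a\<bar>"
    by (intro mult_left_mono) auto
  then show ?thesis
    by (simp add: power2_eq_square)
qed simp

text \<open>Each coordinate is bounded by its own square, hence by \<open>m\<close>, so all triples
  lie in a finite box. Finiteness matters because \<open>card\<close> is 0 on infinite sets.\<close>

lemma finite_square_triples: "finite (square_triples m)"
proof (rule finite_subset)
  show "square_triples m \<subseteq> {-m..m} \<times> {-m..m} \<times> {-m..m}"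
  proof
    fix p assume "p \<in> square_triples m"
    then obtain a b c where p: "p = (a, b, c)" and m: "a\<^sup>2 + b\<^sup>2 + c\<^sup>2 = m"
      by (auto simp: square_triples_def)
    have "\<bar>a\<bar> \<le> m \<and> \<bar>b\<bar> \<le> m \<and> \<bar>c\<bar> \<le> m"
      using m abs_le_power2_int[of a] abs_le_power2_int[of b] abs_le_power2_int[of c] by linarith
    then show "p \<in> {-m..m} \<times> {-m..m} \<times> {-m..m}"
      by (auto simp: p)
  qed
qed simp

text \<open>The difference \<open>t ^ N - a ^ N\<close> is a multiple of \<open>t - a\<close>. For
  \<open>a = 2\<close> this trades the varying number \<open>t ^ N\<close> for the fixed
  \<open>2 ^ N\<close>, which has only finitely many divisors.\<close>

lemma dvd_diff_power_iff: "t - a dvd t ^ N \<longleftrightarrow> t - a dvd a ^ N" for t a :: "'a::comm_ring_1"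
proof -
  have "t - a dvd t ^ N - a ^ N"
    by (simp add: power_diff_sumr2)
  then show ?thesis
    by (metis diff_add_cancel dvd_add_right_iff)
qed

lemma admissible_eq:
  "admissible N = (\<lambda>k. 2 + 2 ^ k) ` {0..N} \<union> (\<lambda>k. 2 - 2 ^ k) ` {0..N}" (is "_ = ?R")
proof (intro equalityI subsetI)
  fix t assume "t \<in> admissible N"
  then have "t - 2 dvd 2 ^ N"
    using dvd_diff_power_iff by (auto simp: admissible_def)
  then have "nat \<bar>t - 2\<bar> dvd 2 ^ N"
    by (simp add: nat_abs_dvd_iff)
  then obtain k where k: "k \<le> N" "nat \<bar>t - 2\<bar> = 2 ^ k"
    using divides_primepow_nat[OF two_is_prime_nat] by blast
  then have "\<bar>t - 2\<bar> = 2 ^ k"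
    by (metis abs_ge_zero int_nat_eq of_nat_numeral of_nat_power)
  then have "t = 2 + 2 ^ k \<or> t = 2 - 2 ^ k"
    by linarith
  then show "t \<in> ?R"
    using k by auto
next
  fix t assume "t \<in> ?R"
  then obtain k where k: "k \<le> N" "t - 2 = 2 ^ k \<or> t - 2 = - (2 ^ k)"
    by auto
  then have "t - 2 dvd 2 ^ N"
    by (auto intro: le_imp_power_dvd)
  moreover have "t \<noteq> 2"
    using k by auto
  ultimately show "t \<in> admissible N"
    using dvd_diff_power_iff by (auto simp: admissible_def)
qed

lemma finite_admissible: "finite (admissible N)"
  by (simp add: admissible_eq)

text \<open>No value of \<open>t\<close> is counted twice: the sign of \<open>t - 2\<close>
  separates the two families, and within each one \<open>2 ^ k\<close> determines
  \<open>k\<close>.\<close>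

lemma sum_admissible:
  fixes f :: "int \<Rightarrow> 'a::comm_monoid_add"
  shows "(\<Sum>t\<in>admissible N. f t) = (\<Sum>k = 0..N. f (2 + 2 ^ k) + f (2 - 2 ^ k))"
proof -
  have "2 + 2 ^ k \<noteq> (2 - 2 ^ l :: int)" for k l
    using zero_less_power[of "2::int" k] zero_less_power[of "2::int" l] by linarith
  then have disj: "(\<lambda>k. 2 + 2 ^ k :: int) ` {0..N} \<inter> (\<lambda>k. 2 - 2 ^ k) ` {0..N} = {}"
    by auto
  have "inj_on (\<lambda>k. 2 + 2 ^ k :: int) {0..N}" "inj_on (\<lambda>k. 2 - 2 ^ k :: int) {0..N}"
    by (auto simp: inj_on_def)
  with disj show ?thesis
    by (simp add: admissible_eq sum.union_disjoint sum.reindex sum.distrib)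
qed

section \<open>The system and its parametrisation\<close>

lemma T_sys_subset_E_sys: "n \<ge> 12 \<Longrightarrow> T_sys n \<subseteq> E_sys n"
  by (auto simp: T_sys_def E_sys_def)

text \<open>Writing \<open>n = m + 12\<close> turns every truncated subtraction \<open>n - j\<close>
  into a sum, so that the indices can be compared by simplification.\<close>

lemma in_solutions_T_sys_iff:
  "x \<in> solutions (m + 12) (T_sys (m + 12)) \<longleftrightarrow>
     x \<in> {1..m + 12} \<rightarrow>\<^sub>E UNIV \<and>
     (\<forall>i\<in>{1..m}. x i * x i = x (i + 1)) \<and>
     x (m + 2) * x (m + 2) = x (m + 2) \<and>
     x (m + 2) + x (m + 2) = x (m + 3) \<and>
     x (m + 4) + x (m + 3) = x 1 \<and>
     x (m + 4) * x (m + 5) = x (m + 1) \<and>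
     x (m + 2) * x (m + 5) = x (m + 5) \<and>
     x (m + 6) * x (m + 6) = x (m + 7) \<and>
     x (m + 8) * x (m + 8) = x (m + 9) \<and>
     x (m + 10) * x (m + 10) = x (m + 11) \<and>
     x (m + 7) + x (m + 9) = x (m + 12) \<and>
     x (m + 11) + x (m + 12) = x (m + 1)"
proof -
  have "T_sys (m + 12) = (\<lambda>i. Mul i i (i + 1)) ` {1..m} \<union>
     {Mul (m + 2) (m + 2) (m + 2),
      Add (m + 2) (m + 2) (m + 3),
      Add (m + 4) (m + 3) 1,
      Mul (m + 4) (m + 5) (m + 1),
      Mul (m + 2) (m + 5) (m + 5),
      Mul (m + 6) (m + 6) (m + 7),
      Mul (m + 8) (m + 8) (m + 9),
      Mul (m + 10) (m + 10) (m + 11),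
      Add (m + 7) (m + 9) (m + 12),
      Add (m + 11) (m + 12) (m + 1)}"
    by (simp add: T_sys_def setcompr_eq_image add.commute atLeastAtMost_def atLeast_def atMost_def
        flip: Collect_conj_eq)
  then show ?thesis
    by (simp only: solutions_def mem_Collect_eq ball_Un ball_simps holds.simps simp_thms)
qed

text \<open>The list gives the variables with indices \<open>m + 2\<close> to \<open>m + 12\<close>.
  The restricted lambda makes the tuple extensional, as \<open>solutions\<close> demands.\<close>

definition solution_of :: "nat \<Rightarrow> int \<times> int \<times> int \<times> int \<times> int \<Rightarrow> nat \<Rightarrow> int" where
  "solution_of m = (\<lambda>(e, t, a, b, c). \<lambda>i\<in>{1..m + 12}.
     if i \<le> m + 1 then t ^ 2 ^ (i - 1)
     else [e, 2 * e, t - 2 * e, t ^ 2 ^ m div (t - 2), a, a\<^sup>2, b, b\<^sup>2, c, c\<^sup>2, a\<^sup>2 + b\<^sup>2] ! (i - (m + 2)))"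

definition parameters_of :: "nat \<Rightarrow> (nat \<Rightarrow> int) \<Rightarrow> int \<times> int \<times> int \<times> int \<times> int" where
  "parameters_of m x = (x (m + 2), x 1, x (m + 6), x (m + 8), x (m + 10))"

definition parameters :: "nat \<Rightarrow> (int \<times> int \<times> int \<times> int \<times> int) set" where
  "parameters N = insert (0, 0, 0, 0, 0)
     ({1} \<times> (SIGMA t:admissible N. square_triples (t ^ N)))"

lemma solution_of_simps:
  "i \<in> {1..m + 1} \<Longrightarrow> solution_of m (e, t, a, b, c) i = t ^ 2 ^ (i - 1)"
  "solution_of m (e, t, a, b, c) (m + 2) = e"
  "solution_of m (e, t, a, b, c) (m + 3) = 2 * e"
  "solution_of m (e, t, a, b, c) (m + 4) = t - 2 * e"
  "solution_of m (e, t, a, b, c) (m + 5) = t ^ 2 ^ m div (t - 2)"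
  "solution_of m (e, t, a, b, c) (m + 6) = a"
  "solution_of m (e, t, a, b, c) (m + 7) = a\<^sup>2"
  "solution_of m (e, t, a, b, c) (m + 8) = b"
  "solution_of m (e, t, a, b, c) (m + 9) = b\<^sup>2"
  "solution_of m (e, t, a, b, c) (m + 10) = c"
  "solution_of m (e, t, a, b, c) (m + 11) = c\<^sup>2"
  "solution_of m (e, t, a, b, c) (m + 12) = a\<^sup>2 + b\<^sup>2"
  by (simp_all add: solution_of_def)

lemma parameters_of_solution_of: "parameters_of m (solution_of m p) = p"
proof -
  obtain e t a b c where p: "p = (e, t, a, b, c)"
    by (cases p)
  have "solution_of m p 1 = t"
    using solution_of_simps(1)[of 1 m] by (simp add: p)
  \<comment> \<open>Deleting \<open>add_2_eq_Suc'\<close> keeps \<open>m + 2\<close> in the form in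
    which \<open>solution_of_simps\<close> mentions it.\<close>
  then show ?thesis
    by (simp add: p parameters_of_def solution_of_simps(2-) del: add_2_eq_Suc')
qed

lemma solution_of_in_solutions:
  assumes "p \<in> parameters (2 ^ m)"
  shows "solution_of m p \<in> solutions (m + 12) (T_sys (m + 12))"
proof -
  obtain e t a b c where p: "p = (e, t, a, b, c)"
    by (cases p)
  have cases: "e = 0 \<and> t = 0 \<and> a = 0 \<and> b = 0 \<and> c = 0 \<or>
      e = 1 \<and> t \<noteq> 2 \<and> t - 2 dvd t ^ 2 ^ m \<and> a\<^sup>2 + b\<^sup>2 + c\<^sup>2 = t ^ 2 ^ m"
    using assms by (auto simp: p parameters_def admissible_def square_triples_def)
  have "solution_of m p \<in> {1..m + 12} \<rightarrow>\<^sub>E UNIV"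
    by (simp add: p solution_of_def)
  moreover have "solution_of m p i * solution_of m p i = solution_of m p (i + 1)"
    if i: "i \<in> {1..m}" for i
  proof -
    \<comment> \<open>Squaring doubles the exponent; \<open>i\<close> is positive, so
      \<open>i - 1\<close> is not truncated.\<close>
    have "(2::nat) ^ i = 2 ^ (i - 1) + 2 ^ (i - 1)"
      using i by (cases i) auto
    then show ?thesis
      using i by (simp add: p solution_of_simps(1) flip: power_add)
  qed
  moreover have "solution_of m p 1 = t" "solution_of m p (m + 1) = t ^ 2 ^ m"
    using solution_of_simps(1)[of 1 m] solution_of_simps(1)[of "m + 1" m] by (simp_all add: p)
  \<comment> \<open>For the zero tuple these equations hold because \<open>2 ^ m\<close> is
    positive, whence \<open>0 ^ 2 ^ m = 0\<close> and the quotient is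
    \<open>0 div (-2) = 0\<close>.\<close>
  moreover have "e * e = e" "(t - 2 * e) * (t ^ 2 ^ m div (t - 2)) = t ^ 2 ^ m"
    "e * (t ^ 2 ^ m div (t - 2)) = t ^ 2 ^ m div (t - 2)" "c\<^sup>2 + (a\<^sup>2 + b\<^sup>2) = t ^ 2 ^ m"
    using cases by (auto simp: zero_power)
  ultimately show ?thesis
    unfolding in_solutions_T_sys_iff
    by (simp add: p solution_of_simps(2-) del: add_2_eq_Suc' flip: power2_eq_square)
qed

text \<open>The five parameters determine the chain of squares and all the sums. Only
  \<open>x (m + 5)\<close> needs an argument, since it enters through products: it is the quotient
  of \<open>t ^ 2 ^ m\<close> by \<open>t - 2\<close>.\<close>

lemma solution_inversion:
  assumes "x \<in> solutions (m + 12) (T_sys (m + 12))"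
  shows "parameters_of m x \<in> parameters (2 ^ m)"
    and "solution_of m (parameters_of m x) = x"
proof -
  define e t a b c where defs: "e = x (m + 2)" "t = x 1" "a = x (m + 6)"
    "b = x (m + 8)" "c = x (m + 10)"
  have sys: "x \<in> {1..m + 12} \<rightarrow>\<^sub>E UNIV" "\<And>i. i \<in> {1..m} \<Longrightarrow> x i * x i = x (i + 1)"
    "e * e = e" "e + e = x (m + 3)" "x (m + 4) + x (m + 3) = t"
    "x (m + 4) * x (m + 5) = x (m + 1)" "e * x (m + 5) = x (m + 5)"
    "a * a = x (m + 7)" "b * b = x (m + 9)" "c * c = x (m + 11)"
    "x (m + 7) + x (m + 9) = x (m + 12)" "x (m + 11) + x (m + 12) = x (m + 1)"
    using assms unfolding in_solutions_T_sys_iff defs by blast+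
  have "x (i + 1) = t ^ 2 ^ i" if "i \<le> m" for i
    using that
  proof (induction i)
    case (Suc i)
    then show ?case
      using sys(2)[of "Suc i"] by (simp add: mult_2 power_add)
  qed (simp add: defs)
  then have pow: "x i = t ^ 2 ^ (i - 1)" if "i \<in> {1..m + 1}" for i
    using that by (cases i) auto
  have last: "x (m + 1) = t ^ 2 ^ m"
    using pow[of "m + 1"] by simp
  have x4: "x (m + 4) = t - 2 * e" and squares: "a\<^sup>2 + b\<^sup>2 + c\<^sup>2 = t ^ 2 ^ m"
    using sys last by (simp_all add: power2_eq_square)
  have "e = 0 \<or> e = 1"
    using sys(3) by simp
  then have key: "(e, t, a, b, c) \<in> parameters (2 ^ m) \<and> x (m + 5) = t ^ 2 ^ m div (t - 2)"
  proof
    \<comment> \<open>The equation \<open>e * x (m + 5) = x (m + 5)\<close> kills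
      \<open>x (m + 5)\<close>, then the power of \<open>t\<close>, and finally the three
      squares.\<close>
    assume e: "e = 0"
    then have x5: "x (m + 5) = 0"
      using sys(7) by simp
    then have "t = 0"
      using sys(6) last by simp
    moreover from this have "a\<^sup>2 + b\<^sup>2 + c\<^sup>2 = 0"
      using squares by (simp add: zero_power)
    then have "a = 0 \<and> b = 0 \<and> c = 0"
      by (smt (verit) power2_eq_square zero_le_power2 zero_eq_power2)
    ultimately show ?thesis
      using e x5 by (simp add: parameters_def zero_power)
  next
    assume e: "e = 1"
    then have prod: "(t - 2) * x (m + 5) = t ^ 2 ^ m"
      using sys(6) x4 last by simp
    \<comment> \<open>Otherwise \<open>prod\<close> would read \<open>0 = 2 ^ 2 ^ m\<close>.\<close>
    then have "t \<noteq> 2"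
      by auto
    then have "x (m + 5) = t ^ 2 ^ m div (t - 2)"
      using prod by (metis eq_iff_diff_eq_0 nonzero_mult_div_cancel_left)
    moreover have "t - 2 dvd t ^ 2 ^ m"
      using prod by (metis dvd_triv_left)
    ultimately show ?thesis
      using squares e \<open>t \<noteq> 2\<close> by (simp add: parameters_def admissible_def square_triples_def)
  qed
  have params: "parameters_of m x = (e, t, a, b, c)"
    by (simp add: parameters_of_def defs)
  show "parameters_of m x \<in> parameters (2 ^ m)"
    using key by (simp add: params)
  show "solution_of m (parameters_of m x) = x"
  proof (rule PiE_ext)
    show "solution_of m (parameters_of m x) \<in> {1..m + 12} \<rightarrow>\<^sub>E UNIV"
      by (simp add: params solution_of_def)
    fix i assume i: "i \<in> {1..m + 12}"
    show "solution_of m (parameters_of m x) i = x i"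
    proof (cases "i \<le> m + 1")
      case True
      then show ?thesis
        using i pow by (simp add: params solution_of_simps(1))
    next
      case False
      \<comment> \<open>The eleven remaining indices are listed explicitly, so that each meets its
        own rule from \<open>solution_of_simps\<close>.\<close>
      then have "i - m \<in> {2..12}" and "i = m + (i - m)"
        using i by auto
      moreover have "{2..12} = {2, 3, 4, 5, 6, 7, 8, 9, 10, 11, 12::nat}"
        by (simp add: atLeastAtMost_upt)
      ultimately have "i \<in> (+) m ` {2, 3, 4, 5, 6, 7, 8, 9, 10, 11, 12}"
        by (metis imageI)
      then show ?thesis
        using key x4 sys(4,8-11)
        by (auto simp: params solution_of_simps power2_eq_square defs(1,3-5) simp del: add_2_eq_Suc')
    qed
  qed (use sys(1) in simp)
qed

lemma bij_betw_solutions: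
  "bij_betw (parameters_of m) (solutions (m + 12) (T_sys (m + 12))) (parameters (2 ^ m))"
  by (rule bij_betw_byWitness[where f' = "solution_of m"])
    (auto simp: solution_inversion parameters_of_solution_of solution_of_in_solutions)

section \<open>Counting the parameters\<close>

lemma finite_parameters: "finite (parameters N)"
  by (simp add: parameters_def finite_admissible finite_square_triples)

text \<open>The summand 1 is the zero tuple. Its first component 0 keeps it apart from the other
  parameters, even from \<open>(1, 0, 0, 0, 0)\<close>, which occurs when \<open>N\<close> is
  positive, as \<open>t = 2 - 2 ^ 1\<close> is then admissible.\<close>

lemma card_parameters:
  "card (parameters N) = 1 + (\<Sum>k = 0..N. r3 ((2 + 2 ^ k) ^ N) + r3 ((2 - 2 ^ k) ^ N))"
proof -
  have "card (parameters N) = 1 + (\<Sum>t\<in>admissible N. r3 (t ^ N))"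
    by (simp add: parameters_def finite_admissible finite_square_triples card_insert_if
        card_cartesian_product r3_eq_card_square_triples)
  then show ?thesis
    by (simp add: sum_admissible)
qed

theorem theorem2:
  fixes n :: nat
  assumes "n \<ge> 12"
  shows "T_sys n \<subseteq> E_sys n \<and>
    finite (solutions n (T_sys n)) \<and>
    card (solutions n (T_sys n)) =
      1 + (\<Sum>k = 0..2 ^ (n - 12).
             r3 ((2 + 2 ^ k) ^ (2 ^ (n - 12))) + r3 ((2 - 2 ^ k) ^ (2 ^ (n - 12))))"
proof -
  define m where "m = n - 12"
  then have n: "n = m + 12"
    using assms by simp
  have "finite (solutions n (T_sys n))"
    using bij_betw_finite[OF bij_betw_solutions] finite_parameters by (simp add: n)
  moreover have "card (solutions n (T_sys n)) = card (parameters (2 ^ m))"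
    using bij_betw_same_card[OF bij_betw_solutions] by (simp add: n)
  ultimately show ?thesis
    using T_sys_subset_E_sys[OF assms] by (simp add: card_parameters m_def)
qed

end
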